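(* Let $J$ be one-homogeneous, $f\in\mathcal H$ be arbitrary, $\alpha>0$, and let $$u^\alpha\in\arg\min_{u\in\mathcal U}\left(\tfrac12\|Ku-f\|_{\mathcal H}^2+\alpha J(u)\right).$$ Then $$\|Ku^\alpha\|_{\mathcal H}\le\max\{\|f\|_{\mathcal H}-\alpha\lambda_0,\,0\},$$ where $\lambda_0$ is the smallest singular value. As a direct consequence, if $\|f\|_{\mathcal H}\ge\alpha\lambda_0$, then $$\|Ku^\alpha-f\|_{\mathcal H}\ge\alpha\lambda_0,$$ which is sharp if $u^\alpha$ is a multiple of the ground state $u_0$.
   Context: Setting: $\mathcal U$ is a Banach space that is the dual of some Banach space, $\mathcal H$ is a Hilbert space, $K:\mathcal U\to\mathcal H$ is a bounded linear operator, and $J:\mathrm{dom}(J)\subseteq\mathcal U\to\mathbb{R}\cup\{+\infty\}$ is proper, convex and non-negative. One-homogeneous means $J(cu)=|c|J(u)$ for all $c\in\mathbb{R}$. Let $\ker(J)=\{u\in\mathrm{dom}(J): J(u)=0\}$ and $\ker(J)^\bot=\{u\in\mathrm{dom}(J): \langle Ku,Kv\rangle_{\mathcal H}=0\ \forall v\in\ker(J)\}$. A ground state is an element $$u_0\in\arg\min\{J(u): u\in\ker(J)^\bot,\ \|Ku\|_{\mathcal H}=1\},$$ and, if $u_0$ exists (as is understood here), $\lambda_0=J(u_0)$ is called the smallest singular value.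
   Formalization: As stated this is false; the formal version assumes ⟨f,Kv⟩=0 for all v in ker(J), proves equality for multiples of u_0 only when f is a multiple of Ku_0, and shows equality is attained by suitable data when dom(J)=ker(J)+ker(J)^⊥. *)

theory Defs
  imports "HOL-Analysis.Analysis"
begin

text \<open>
  An extended-valued functional on a real vector space is a total function into \<^typ>\<open>ereal\<close>;
  outside its domain it takes the value \<open>\<infinity>\<close>.
\<close>

definition edom :: "('u \<Rightarrow> ereal) \<Rightarrow> 'u set" where
  "edom J = {u. J u < \<infinity>}"

definition proper_fun :: "('u \<Rightarrow> ereal) \<Rightarrow> bool" where
  "proper_fun J \<longleftrightarrow> (\<forall>u. J u \<noteq> -\<infinity>) \<and> edom J \<noteq> {}"

text \<open>
  In \<^typ>\<open>ereal\<close> we have \<open>0 * \<infinity> = 0\<close>, so for functionals that never take the value \<open>-\<infinity>\<close> the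
  endpoint cases of the following inequality hold trivially.
\<close>

definition convex_fun :: "('u::real_vector \<Rightarrow> ereal) \<Rightarrow> bool" where
  "convex_fun J \<longleftrightarrow> (\<forall>u v. \<forall>t::real. 0 \<le> t \<and> t \<le> 1 \<longrightarrow>
     J ((1 - t) *\<^sub>R u + t *\<^sub>R v) \<le> ereal (1 - t) * J u + ereal t * J v)"

text \<open>By the same convention, the case \<open>c = 0\<close> below says \<open>J 0 = 0\<close>.\<close>

definition one_homogeneous :: "('u::real_vector \<Rightarrow> ereal) \<Rightarrow> bool" where
  "one_homogeneous J \<longleftrightarrow> (\<forall>c u. J (c *\<^sub>R u) = ereal \<bar>c\<bar> * J u)"

definition fun_ker :: "('u \<Rightarrow> ereal) \<Rightarrow> 'u set" where
  "fun_ker J = {u \<in> edom J. J u = 0}"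

definition ker_perp ::
    "('u::real_normed_vector \<Rightarrow>\<^sub>L 'h::real_inner) \<Rightarrow> ('u \<Rightarrow> ereal) \<Rightarrow> 'u set" where
  "ker_perp K J = {u \<in> edom J. \<forall>v \<in> fun_ker J. inner (blinfun_apply K u) (blinfun_apply K v) = 0}"

definition ground_state ::
    "('u::real_normed_vector \<Rightarrow>\<^sub>L 'h::real_inner) \<Rightarrow> ('u \<Rightarrow> ereal) \<Rightarrow> 'u \<Rightarrow> bool" where
  "ground_state K J u0 \<longleftrightarrow>
     is_arg_min J (\<lambda>u. u \<in> ker_perp K J \<and> norm (blinfun_apply K u) = 1) u0"

definition var_objective ::
    "('u::real_normed_vector \<Rightarrow>\<^sub>L 'h::real_inner) \<Rightarrow> ('u \<Rightarrow> ereal) \<Rightarrow> 'h \<Rightarrow> real \<Rightarrow> 'u \<Rightarrow> ereal" where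
  "var_objective K J f \<alpha> u =
     ereal (1 / 2 * (norm (blinfun_apply K u - f))\<^sup>2) + ereal \<alpha> * J u"

definition var_minimizer ::
    "('u::real_normed_vector \<Rightarrow>\<^sub>L 'h::real_inner) \<Rightarrow> ('u \<Rightarrow> ereal) \<Rightarrow> 'h \<Rightarrow> real \<Rightarrow> 'u \<Rightarrow> bool" where
  "var_minimizer K J f \<alpha> u \<longleftrightarrow> is_arg_min (var_objective K J f \<alpha>) (\<lambda>_. True) u"

end

theory Submission
  imports Defs
begin

text \<open>
  Varying a minimiser \<open>u\<close> along the ray through \<open>u\<close> gives
  \<open>\<alpha> J(u) = \<langle>f, K u\<rangle> - \<parallel>K u\<parallel>\<^sup>2\<close>, and varying it along \<open>ker J\<close> shows that \<open>u\<close> lies in the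
  orthogonal complement of \<open>ker J\<close>, where \<open>\<lambda>\<^sub>0 \<parallel>K u\<parallel> \<le> J(u)\<close> by homogeneity. Cauchy--Schwarz then
  gives the bound. For sharpness, the datum is \<open>(c \<plusminus> \<alpha>\<lambda>\<^sub>0) K u\<^sub>0\<close>, with the sign of \<open>c\<close>: projecting
  onto the unit vector \<open>K u\<^sub>0\<close> reduces minimality of \<open>c u\<^sub>0\<close> to soft thresholding on the real line.
\<close>

section \<open>Auxiliary facts on the real line and in inner product spaces\<close>

lemma linear_term_zero:
  fixes a b :: real
  assumes "\<And>s. \<bar>s\<bar> \<le> 1 \<Longrightarrow> 0 \<le> s * b + s\<^sup>2 * a"
  shows "b = 0"
proof (rule ccontr)
  assume b: "b \<noteq> 0"
  \<comment> \<open>At \<open>s = - b / N\<close> the expression equals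
    \<open>(b\<^sup>2 / N\<^sup>2) * (a - N)\<close>, negative since \<open>a < N\<close>; the
    summand \<open>\<bar>b\<bar>\<close> keeps \<open>\<bar>s\<bar> \<le> 1\<close>.\<close>
  define N where "N = \<bar>b\<bar> + \<bar>a\<bar> + 1"
  have N: "N > 0" "\<bar>b\<bar> \<le> N" "a < N" by (auto simp: N_def)
  have "\<bar>- b / N\<bar> \<le> 1" using N by (simp add: divide_simps)
  from assms[OF this] have "0 \<le> (b\<^sup>2 / N\<^sup>2) * (a - N)"
    using N by (simp add: field_simps power2_eq_square)
  moreover have "b\<^sup>2 / N\<^sup>2 > 0" using b N by simp
  ultimately have "a - N \<ge> 0" by (metis zero_le_mult_iff less_le_not_le)
  then show False using N by simp
qed

lemma half_norm_add_scaleR_sq: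
  fixes x y :: "'h::real_inner"
  shows "1 / 2 * (norm (x + s *\<^sub>R y))\<^sup>2 = 1 / 2 * (norm x)\<^sup>2 + s * inner x y + s\<^sup>2 * (1 / 2 * (norm y)\<^sup>2)"
  unfolding power2_norm_eq_inner
  by (simp add: inner_add_left inner_add_right inner_commute power2_eq_square algebra_simps)

text \<open>The left side is the value of the right at \<open>x = c\<close>. Expanding about
  \<open>c\<close>, the difference is
  \<open>(x - c)\<^sup>2 / 2 + a * (\<bar>x\<bar> - s * x)\<close>, a sum of nonnegative
  terms.\<close>

lemma soft_thresholding:
  fixes a c s x :: real
  assumes "0 \<le> a" "\<bar>s\<bar> = 1" "s * c = \<bar>c\<bar>"
  shows "1 / 2 * a\<^sup>2 + a * \<bar>c\<bar> \<le> 1 / 2 * (x - (c + s * a))\<^sup>2 + a * \<bar>x\<bar>"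
proof -
  have s2: "s * s = 1" using assms(2) by (metis abs_mult_self_eq mult_1)
  have "s * x \<le> \<bar>x\<bar>" using assms(2) by (metis abs_ge_self abs_mult mult_1)
  then have "a * (s * x) \<le> a * \<bar>x\<bar>" using assms(1) by (rule mult_left_mono)
  moreover have "(x - (c + s * a))\<^sup>2 = (x - c)\<^sup>2 - 2 * (a * (s * x)) + 2 * (a * (s * c)) + (s * s) * a\<^sup>2"
    by (simp add: power2_eq_square algebra_simps)
  ultimately show ?thesis
    using zero_le_power2[of "x - c"] unfolding s2 assms(3) by linarith
qed

section \<open>One-homogeneous functionals and the ground state\<close>

text \<open>The sum is the midpoint of \<open>2 *\<^sub>R u\<close> and
  \<open>2 *\<^sub>R v\<close>; homogeneity absorbs the factor 2.\<close>

lemma one_homogeneous_convex_add: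
  assumes "convex_fun J" "one_homogeneous J" "J u = ereal a" "J v = ereal b"
  shows "J (u + v) \<le> ereal (a + b)"
proof -
  have "J ((1 - 1/2) *\<^sub>R (2 *\<^sub>R u) + (1/2) *\<^sub>R (2 *\<^sub>R v))
      \<le> ereal (1 - 1/2) * J (2 *\<^sub>R u) + ereal (1/2) * J (2 *\<^sub>R v)"
    by (rule assms(1)[unfolded convex_fun_def, rule_format]) simp
  moreover have "J (2 *\<^sub>R w) = ereal 2 * J w" for w
    using assms(2) unfolding one_homogeneous_def by simp
  ultimately show ?thesis using assms(3,4) by simp
qed

text \<open>Scaling \<open>u\<close> so that its image under \<open>K\<close> has norm 1 makes it a
  competitor of \<open>u0\<close>. If the image is 0, only \<open>0 \<le> a\<close> remains to be
  shown.\<close>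

lemma ground_state_le:
  assumes ground: "ground_state K J u0" and lam0: "J u0 = ereal lam0"
    and hom: "one_homogeneous J" and u: "u \<in> ker_perp K J" and a: "J u = ereal a" "0 \<le> a"
  shows "lam0 * norm (blinfun_apply K u) \<le> a"
proof (cases "blinfun_apply K u = 0")
  case True
  then show ?thesis using a by simp
next
  case False
  define n where "n = norm (blinfun_apply K u)"
  have n: "n > 0" using False by (simp add: n_def)
  define v where "v = inverse n *\<^sub>R u"
  have Jv: "J v = ereal (inverse n * a)"
    using hom n a unfolding one_homogeneous_def v_def by simp
  have "v \<in> ker_perp K J"
    using u Jv unfolding ker_perp_def edom_def by (simp add: v_def blinfun.scaleR_right)
  moreover have "norm (blinfun_apply K v) = 1"
    using n by (simp add: v_def blinfun.scaleR_right n_def)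
  ultimately have "\<not> J v < J u0"
    using ground unfolding ground_state_def is_arg_min_def by blast
  then have "lam0 \<le> inverse n * a" using Jv lam0 by simp
  then show ?thesis using n by (simp add: n_def field_simps)
qed

section \<open>Optimality conditions for minimisers\<close>

text \<open>Passes from extended reals to reals. An upper bound on \<open>J v\<close> suffices,
  which is all that subadditivity supplies for kernel directions.\<close>

lemma var_minimizer_le:
  assumes "var_minimizer K J f \<alpha> u" "J u = ereal a" "J v \<le> ereal b" "0 \<le> \<alpha>"
  shows "1 / 2 * (norm (blinfun_apply K u - f))\<^sup>2 + \<alpha> * a
     \<le> 1 / 2 * (norm (blinfun_apply K v - f))\<^sup>2 + \<alpha> * b"
proof -
  have "var_objective K J f \<alpha> u \<le> var_objective K J f \<alpha> v"
    using assms(1) unfolding var_minimizer_def is_arg_min_def by (simp add: not_less)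
  also have "\<dots> \<le> ereal (1 / 2 * (norm (blinfun_apply K v - f))\<^sup>2) + ereal \<alpha> * ereal b"
    unfolding var_objective_def
    by (intro add_left_mono ereal_mult_left_mono assms(3)) (use assms(4) in simp)
  finally show ?thesis using assms(2) by (simp add: var_objective_def)
qed

lemma var_minimizer_finite:
  assumes "var_minimizer K J f \<alpha> u" "one_homogeneous J" "0 \<le> J u" "0 < \<alpha>"
  obtains a where "J u = ereal a" "0 \<le> a"
proof -
  \<comment> \<open>\<open>J u\<close> may still be infinite here, but
    \<open>0 * \<infinity> = 0\<close> gives \<open>J 0 = 0\<close>, so the competitor 0 has a
    finite objective.\<close>
  have "J (0 *\<^sub>R u) = ereal \<bar>0\<bar> * J u"
    using assms(2) unfolding one_homogeneous_def by blast
  then have J0: "J 0 = 0" by (simp add: zero_ereal_def[symmetric])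
  have "var_objective K J f \<alpha> u \<le> var_objective K J f \<alpha> 0"
    using assms(1) unfolding var_minimizer_def is_arg_min_def by (simp add: not_less)
  then have "J u \<noteq> \<infinity>"
    using J0 assms(4) by (auto simp: var_objective_def)
  then show thesis using that assms(3) by (cases "J u") auto
qed

text \<open>\<open>J\<close> needs no derivative along \<open>v\<close>: an affine upper bound that
  is exact at \<open>s = 0\<close> is enough, and allowing both signs of \<open>s\<close> turns the
  inequality into an equation.\<close>

lemma var_minimizer_first_variation:
  assumes "var_minimizer K J f \<alpha> u" "J u = ereal a" "0 \<le> \<alpha>"
    and "\<And>s. \<bar>s\<bar> \<le> 1 \<Longrightarrow> J (u + s *\<^sub>R v) \<le> ereal (a + s * j)"
  shows "inner (blinfun_apply K u - f) (blinfun_apply K v) + \<alpha> * j = 0"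
proof (rule linear_term_zero)
  fix s :: real assume "\<bar>s\<bar> \<le> 1"
  from var_minimizer_le[OF assms(1,2) assms(4)[OF this] assms(3)]
  have "1 / 2 * (norm (blinfun_apply K u - f))\<^sup>2 + \<alpha> * a
      \<le> 1 / 2 * (norm ((blinfun_apply K u - f) + s *\<^sub>R blinfun_apply K v))\<^sup>2 + \<alpha> * (a + s * j)"
    by (simp add: blinfun.add_right blinfun.scaleR_right algebra_simps)
  then show "0 \<le> s * (inner (blinfun_apply K u - f) (blinfun_apply K v) + \<alpha> * j)
      + s\<^sup>2 * (1 / 2 * (norm (blinfun_apply K v))\<^sup>2)"
    unfolding half_norm_add_scaleR_sq by (simp add: algebra_simps)
qed

lemma var_minimizer_euler:
  assumes "var_minimizer K J f \<alpha> u" "J u = ereal a" "0 \<le> \<alpha>" "one_homogeneous J"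
  shows "\<alpha> * a = inner f (blinfun_apply K u) - (norm (blinfun_apply K u))\<^sup>2"
proof -
  \<comment> \<open>For \<open>\<bar>s\<bar> \<le> 1\<close> the factor \<open>1 + s\<close> is
    nonnegative, so \<open>J\<close> is affine along this piece of the ray.\<close>
  have "J (u + s *\<^sub>R u) \<le> ereal (a + s * a)" if "\<bar>s\<bar> \<le> 1" for s
  proof -
    have "J ((1 + s) *\<^sub>R u) = ereal \<bar>1 + s\<bar> * J u"
      using assms(4) unfolding one_homogeneous_def by blast
    then show ?thesis using that assms(2) by (simp add: algebra_simps)
  qed
  from var_minimizer_first_variation[OF assms(1-3) this]
  show ?thesis by (simp add: inner_diff_left power2_norm_eq_inner)
qed

text \<open>Moving along the kernel does not raise \<open>J\<close>, so the residual is orthogonal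
  to the image of the kernel; \<open>orth\<close> transfers this from the residual to
  \<open>K u\<close>.\<close>

lemma var_minimizer_in_ker_perp:
  assumes "var_minimizer K J f \<alpha> u" "J u = ereal a" "0 \<le> \<alpha>"
    and "convex_fun J" "one_homogeneous J"
    and orth: "\<And>v. v \<in> fun_ker J \<Longrightarrow> inner f (blinfun_apply K v) = 0"
  shows "u \<in> ker_perp K J"
proof -
  have "inner (blinfun_apply K u) (blinfun_apply K v) = 0" if v: "v \<in> fun_ker J" for v
  proof -
    have "J (s *\<^sub>R v) = ereal 0" for s
      using assms(5) v unfolding one_homogeneous_def fun_ker_def by (simp add: zero_ereal_def)
    from one_homogeneous_convex_add[OF assms(4,5,2) this]
    have "J (u + s *\<^sub>R v) \<le> ereal (a + s * 0)" for s by simp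
    from var_minimizer_first_variation[OF assms(1-3) this]
    show ?thesis using orth[OF v] by (simp add: inner_diff_left)
  qed
  then show ?thesis using assms(2) by (simp add: ker_perp_def edom_def)
qed

section \<open>The norm bound\<close>

lemma var_minimizer_norm_le:
  assumes min: "var_minimizer K J f \<alpha> u" and alpha: "0 < \<alpha>" and nonneg: "0 \<le> J u"
    and "convex_fun J" and hom: "one_homogeneous J"
    and ground: "ground_state K J u0" "J u0 = ereal lam0"
    and orth: "\<And>v. v \<in> fun_ker J \<Longrightarrow> inner f (blinfun_apply K v) = 0"
  shows "norm (blinfun_apply K u) \<le> max (norm f - \<alpha> * lam0) 0"
proof -
  let ?n = "norm (blinfun_apply K u)"
  obtain a where a: "J u = ereal a" "0 \<le> a"
    using var_minimizer_finite[OF min hom nonneg alpha] .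
  have "u \<in> ker_perp K J"
    using var_minimizer_in_ker_perp[OF min a(1) _ assms(4) hom orth] alpha by simp
  from ground_state_le[OF ground hom this a] alpha
  have "\<alpha> * (lam0 * ?n) \<le> \<alpha> * a" by simp
  also have "\<dots> = inner f (blinfun_apply K u) - ?n\<^sup>2"
    using var_minimizer_euler[OF min a(1) _ hom] alpha by simp
  also have "\<dots> \<le> norm f * ?n - ?n\<^sup>2"
    using norm_cauchy_schwarz[of f "blinfun_apply K u"] by simp
  finally have "?n * ?n \<le> (norm f - \<alpha> * lam0) * ?n"
    by (simp add: power2_eq_square algebra_simps)
  \<comment> \<open>Cancelling \<open>?n\<close> requires it to be nonzero; the entry 0 of the
    maximum covers the other case.\<close>
  then show ?thesis
    by (cases "?n = 0") (auto simp: mult_le_cancel_right)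
qed

section \<open>Sharpness on the line spanned by the ground state\<close>

text \<open>The residual is \<open>\<bar>c - \<gamma>\<bar>\<close>. For \<open>c \<noteq> 0\<close>
  the Euler relation, divided by \<open>\<bar>c\<bar>\<close>, gives its value; for
  \<open>c = 0\<close> that relation is void and a competitor on the line is used instead.\<close>

lemma var_minimizer_residual_eq:
  assumes min: "var_minimizer K J (\<gamma> *\<^sub>R blinfun_apply K u0) \<alpha> (c *\<^sub>R u0)" and alpha: "0 < \<alpha>"
    and lam0: "J u0 = ereal lam0" "0 \<le> lam0" and hom: "one_homogeneous J"
    and unit: "norm (blinfun_apply K u0) = 1" and \<gamma>: "\<alpha> * lam0 \<le> \<bar>\<gamma>\<bar>"
  shows "norm (blinfun_apply K (c *\<^sub>R u0) - \<gamma> *\<^sub>R blinfun_apply K u0) = \<alpha> * lam0"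
proof -
  let ?e = "blinfun_apply K u0"
  have J: "J (t *\<^sub>R u0) = ereal (\<bar>t\<bar> * lam0)" for t
    using hom lam0 unfolding one_homogeneous_def by simp
  have norm_e: "norm (blinfun_apply K (t *\<^sub>R u0) - \<gamma> *\<^sub>R ?e) = \<bar>t - \<gamma>\<bar>" for t
    using unit by (simp add: blinfun.scaleR_right scaleR_diff_left[symmetric])
  have ee: "inner ?e ?e = 1" using unit by (simp add: norm_eq_1)
  have "\<bar>c - \<gamma>\<bar> = \<alpha> * lam0"
  proof (cases "c = 0")
    case True
    \<comment> \<open>comparison with the soft-thresholded value of \<open>\<gamma>\<close>\<close>
    define t where "t = (if 0 \<le> \<gamma> then \<gamma> - \<alpha> * lam0 else \<gamma> + \<alpha> * lam0)"
    have t: "\<bar>t\<bar> = \<bar>\<gamma>\<bar> - \<alpha> * lam0" "(t - \<gamma>)\<^sup>2 = (\<alpha> * lam0)\<^sup>2"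
      using \<gamma> by (auto simp: t_def)
    have "1 / 2 * \<gamma>\<^sup>2 \<le> 1 / 2 * (t - \<gamma>)\<^sup>2 + \<alpha> * (\<bar>t\<bar> * lam0)"
      using var_minimizer_le[OF min J eq_refl[OF J[of t]]] alpha True
      unfolding norm_e by simp
    then have "\<bar>\<gamma>\<bar>\<^sup>2 \<le> (\<alpha> * lam0)\<^sup>2 + 2 * ((\<alpha> * lam0) * (\<bar>\<gamma>\<bar> - \<alpha> * lam0))"
      unfolding t by (simp add: mult_ac)
    \<comment> \<open>The comparison closes up to a perfect square, forcing
      \<open>\<bar>\<gamma>\<bar> = \<alpha> * lam0\<close>.\<close>
    then have "(\<bar>\<gamma>\<bar> - \<alpha> * lam0)\<^sup>2 \<le> 0"
      unfolding power2_diff by (simp add: power2_eq_square algebra_simps)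
    then show ?thesis using True by simp
  next
    case False
    have "\<alpha> * (\<bar>c\<bar> * lam0) = \<gamma> * c - c\<^sup>2"
      using var_minimizer_euler[OF min J _ hom] alpha unit
      by (simp add: blinfun.scaleR_right ee power_mult_distrib)
    then have "\<bar>c\<bar> * (\<alpha> * lam0) = c * (\<gamma> - c)"
      by (simp add: power2_eq_square algebra_simps)
    then have "\<bar>c\<bar> * \<bar>\<alpha> * lam0\<bar> = \<bar>c\<bar> * \<bar>\<gamma> - c\<bar>"
      by (metis abs_mult abs_abs)
    then show ?thesis using False alpha lam0(2) by (simp add: abs_minus_commute)
  qed
  then show ?thesis by (simp add: norm_e)
qed

text \<open>The ground state inequality is available only on \<open>ker_perp K J\<close>;
  \<open>decomp\<close> reduces an arbitrary competitor to that set.\<close>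

lemma ground_state_multiple_var_minimizer:
  assumes alpha: "0 < \<alpha>" and nonneg: "\<And>u. 0 \<le> J u"
    and convex: "convex_fun J" and hom: "one_homogeneous J"
    and ground: "ground_state K J u0" and lam0: "J u0 = ereal lam0"
    and decomp: "\<And>u. u \<in> edom J \<Longrightarrow> \<exists>v \<in> fun_ker J. u - v \<in> ker_perp K J"
    and s: "\<bar>s\<bar> = 1" "s * c = \<bar>c\<bar>"
  shows "var_minimizer K J ((c + s * (\<alpha> * lam0)) *\<^sub>R blinfun_apply K u0) \<alpha> (c *\<^sub>R u0)"
proof -
  let ?e = "blinfun_apply K u0" and ?a = "\<alpha> * lam0"
  define g where "g = (c + s * ?a) *\<^sub>R ?e"
  have u0: "u0 \<in> ker_perp K J" and unit: "norm ?e = 1"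
    using ground by (auto simp: ground_state_def is_arg_min_def)
  have ee: "inner ?e ?e = 1" using unit by (simp add: norm_eq_1)
  have lam0_nonneg: "0 \<le> lam0" using nonneg[of u0] lam0 by simp
  have "blinfun_apply K (c *\<^sub>R u0) - g = - (s * ?a) *\<^sub>R ?e"
    by (simp add: g_def blinfun.scaleR_right algebra_simps)
  then have "norm (blinfun_apply K (c *\<^sub>R u0) - g) = ?a"
    using s unit alpha lam0_nonneg by (simp add: abs_mult)
  moreover have "J (c *\<^sub>R u0) = ereal (\<bar>c\<bar> * lam0)"
    using hom lam0 unfolding one_homogeneous_def by simp
  ultimately have obj: "var_objective K J g \<alpha> (c *\<^sub>R u0) = ereal (1 / 2 * ?a\<^sup>2 + ?a * \<bar>c\<bar>)"
    by (simp add: var_objective_def mult_ac)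
  have "ereal (1 / 2 * ?a\<^sup>2 + ?a * \<bar>c\<bar>) \<le> var_objective K J g \<alpha> u" for u
  proof (cases "J u")
    case (real j)
    then obtain v where v: "v \<in> fun_ker J" and p: "u - v \<in> ker_perp K J"
      using decomp[of u] by (auto simp: edom_def)
    \<comment> \<open>Subtracting \<open>v\<close> does not increase \<open>J\<close> and, as
      \<open>u0\<close> is in \<open>ker_perp K J\<close>, leaves the coordinate \<open>x\<close>
      unchanged. Hence \<open>lam0 * \<bar>x\<bar> \<le> J (u - v) \<le> J u\<close>.\<close>
    define x where "x = inner (blinfun_apply K u) ?e"
    have "J ((-1) *\<^sub>R v) = ereal \<bar>-1\<bar> * J v"
      using hom unfolding one_homogeneous_def by blast
    then have "J (- v) = ereal 0"
      using v by (simp add: fun_ker_def zero_ereal_def)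
    from one_homogeneous_convex_add[OF convex hom real this]
    have Jp: "J (u - v) \<le> ereal j" by simp
    then obtain q where q: "J (u - v) = ereal q" "0 \<le> q"
      using nonneg[of "u - v"] by (cases "J (u - v)") auto
    have "inner ?e (blinfun_apply K v) = 0" using u0 v by (simp add: ker_perp_def)
    then have "x = inner (blinfun_apply K (u - v)) ?e"
      unfolding x_def blinfun.diff_right inner_diff_left by (simp add: inner_commute)
    then have "\<bar>x\<bar> \<le> norm (blinfun_apply K (u - v))"
      using Cauchy_Schwarz_ineq2[of "blinfun_apply K (u - v)" ?e] unit by simp
    then have "lam0 * \<bar>x\<bar> \<le> lam0 * norm (blinfun_apply K (u - v))"
      using lam0_nonneg by (rule mult_left_mono)
    also have "\<dots> \<le> q" by (rule ground_state_le[OF ground lam0 hom p q])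
    also have "\<dots> \<le> j" using Jp q by simp
    finally have "?a * \<bar>x\<bar> \<le> \<alpha> * j" using alpha by (simp add: mult.assoc)
    moreover have "\<bar>x - (c + s * ?a)\<bar> \<le> norm (blinfun_apply K u - g)"
      using Cauchy_Schwarz_ineq2[of "blinfun_apply K u - g" ?e] unit ee
      by (simp add: x_def g_def inner_diff_left)
    then have "(x - (c + s * ?a))\<^sup>2 \<le> (norm (blinfun_apply K u - g))\<^sup>2"
      by (metis abs_ge_zero power2_abs power_mono)
    moreover have "0 \<le> ?a" using alpha lam0_nonneg by simp
    ultimately have "1 / 2 * ?a\<^sup>2 + ?a * \<bar>c\<bar>
        \<le> 1 / 2 * (norm (blinfun_apply K u - g))\<^sup>2 + \<alpha> * j"
      using soft_thresholding[of ?a s c x] s by linarith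
    then show ?thesis using real by (simp add: var_objective_def)
  next
    case PInf
    then show ?thesis using alpha by (simp add: var_objective_def)
  next
    case MInf
    then show ?thesis using nonneg[of u] by simp
  qed
  then show ?thesis
    unfolding g_def[symmetric] var_minimizer_def is_arg_min_def obj by (auto simp: not_less)
qed

text \<open>Sharpness has two halves: equality when the datum lies on the line through
  \<open>K u0\<close>, so that no component off this line enlarges the residual, and, if
  \<open>dom J\<close> splits along the kernel, a datum attaining equality for every multiple of
  \<open>u0\<close>.\<close>

theorem theorem7:
  fixes K :: "('x::banach \<Rightarrow>\<^sub>L real) \<Rightarrow>\<^sub>L 'h::{real_inner, complete_space}"
    and J :: "('x \<Rightarrow>\<^sub>L real) \<Rightarrow> ereal"
    and f :: 'h
    and \<alpha> lam0 :: real
    and u0 u\<alpha> :: "'x \<Rightarrow>\<^sub>L real"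
  assumes proper: "proper_fun J"
    and convex: "convex_fun J"
    and nonneg: "\<And>u. 0 \<le> J u"
    and hom: "one_homogeneous J"
    and alpha: "0 < \<alpha>"
    and ground: "ground_state K J u0"
    and lam0: "J u0 = ereal lam0"
    and minimizer: "var_minimizer K J f \<alpha> u\<alpha>"
    and orth: "\<And>v. v \<in> fun_ker J \<Longrightarrow> inner f (blinfun_apply K v) = 0"
  shows "norm (blinfun_apply K u\<alpha>) \<le> max (norm f - \<alpha> * lam0) 0 \<and>
    (norm f \<ge> \<alpha> * lam0 \<longrightarrow> norm (blinfun_apply K u\<alpha> - f) \<ge> \<alpha> * lam0) \<and>
    (norm f \<ge> \<alpha> * lam0 \<and> (\<exists>c. u\<alpha> = c *\<^sub>R u0) \<and> (\<exists>\<gamma>. f = \<gamma> *\<^sub>R blinfun_apply K u0) \<longrightarrow>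
       norm (blinfun_apply K u\<alpha> - f) = \<alpha> * lam0) \<and>
    ((\<forall>u \<in> edom J. \<exists>v \<in> fun_ker J. u - v \<in> ker_perp K J) \<longrightarrow>
       (\<forall>c. \<exists>g. (\<forall>v \<in> fun_ker J. inner g (blinfun_apply K v) = 0) \<and>
          norm g \<ge> \<alpha> * lam0 \<and>
          var_minimizer K J g \<alpha> (c *\<^sub>R u0) \<and>
          norm (blinfun_apply K (c *\<^sub>R u0) - g) = \<alpha> * lam0))"
proof -
  let ?e = "blinfun_apply K u0"
  have u0: "u0 \<in> ker_perp K J" and unit: "norm ?e = 1"
    using ground by (auto simp: ground_state_def is_arg_min_def)
  have lam0_nonneg: "0 \<le> lam0" using nonneg[of u0] lam0 by simp
  have bound: "norm (blinfun_apply K u\<alpha>) \<le> max (norm f - \<alpha> * lam0) 0"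
    by (rule var_minimizer_norm_le[OF minimizer alpha nonneg convex hom ground lam0 orth])
  \<comment> \<open>Here the maximum is its first entry, and the reverse triangle inequality
    applies.\<close>
  moreover have "norm (blinfun_apply K u\<alpha> - f) \<ge> \<alpha> * lam0" if "norm f \<ge> \<alpha> * lam0"
    using bound that norm_triangle_ineq2[of f "blinfun_apply K u\<alpha>"]
    by (simp add: norm_minus_commute)
  moreover have "norm (blinfun_apply K u\<alpha> - f) = \<alpha> * lam0"
    if "norm f \<ge> \<alpha> * lam0" "u\<alpha> = c *\<^sub>R u0" "f = \<gamma> *\<^sub>R ?e" for c \<gamma>
    using var_minimizer_residual_eq[of K J \<gamma> u0 \<alpha> c lam0] minimizer alpha lam0 lam0_nonneg hom unit that
    by simp
  moreover have "\<exists>g. (\<forall>v \<in> fun_ker J. inner g (blinfun_apply K v) = 0) \<and>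
      norm g \<ge> \<alpha> * lam0 \<and> var_minimizer K J g \<alpha> (c *\<^sub>R u0) \<and>
      norm (blinfun_apply K (c *\<^sub>R u0) - g) = \<alpha> * lam0"
    if decomp: "\<forall>u \<in> edom J. \<exists>v \<in> fun_ker J. u - v \<in> ker_perp K J" for c
  proof -
    \<comment> \<open>not \<open>sgn c\<close>, which vanishes at \<open>c = 0\<close>\<close>
    define s :: real where "s = (if 0 \<le> c then 1 else - 1)"
    have s: "\<bar>s\<bar> = 1" "s * c = \<bar>c\<bar>" by (auto simp: s_def)
    define \<gamma> where "\<gamma> = c + s * (\<alpha> * lam0)"
    have min: "var_minimizer K J (\<gamma> *\<^sub>R ?e) \<alpha> (c *\<^sub>R u0)"
      unfolding \<gamma>_def
      by (rule ground_state_multiple_var_minimizer[OF alpha nonneg convex hom ground lam0 _ s])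
        (use decomp in blast)
    \<comment> \<open>Both summands of \<open>\<gamma>\<close> point in the direction of
      \<open>s\<close>, so their absolute values add.\<close>
    have "\<bar>\<gamma>\<bar> = \<bar>c\<bar> + \<alpha> * lam0"
      using mult_nonneg_nonneg[OF less_imp_le[OF alpha] lam0_nonneg] by (auto simp: \<gamma>_def s_def)
    then have \<gamma>: "\<alpha> * lam0 \<le> \<bar>\<gamma>\<bar>" by simp
    have "\<forall>v \<in> fun_ker J. inner (\<gamma> *\<^sub>R ?e) (blinfun_apply K v) = 0"
      using u0 by (simp add: ker_perp_def)
    moreover have "norm (\<gamma> *\<^sub>R ?e) \<ge> \<alpha> * lam0" using \<gamma> unit by simp
    ultimately show ?thesis
      using min var_minimizer_residual_eq[OF min alpha lam0 lam0_nonneg hom unit \<gamma>] by blast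
  qed
  ultimately show ?thesis by blast
qed

end
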